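(* Let $p$ be a prime, let $r\ge 1$, and let $\varepsilon>0$. (1) Let $G=\mathbb{Z}_{p^r}$ and $H=\mathbb{Z}_{p^s}$ ($s\ge 1$) be cyclic groups and let $f:G\to H$ be any function. Then \[\bigl|\{\varphi\in \mathrm{Hom}(G,H) : \mathrm{agr}(f,\varphi)\ge \varepsilon\}\bigr| \le \frac{p}{p-1}\cdot\frac{1}{\varepsilon^{2}}.\] (2) More generally, if $G=\mathbb{Z}_{p^r}$ and $H$ is a finite abelian group of $p$-rank $t\ge 1$, then for every function $f:G\to H$, $\bigl|\{\varphi\in \mathrm{Hom}(G,H) : \mathrm{agr}(f,\varphi)\ge \varepsilon\}\bigr|\le 2\varepsilon^{-(t+1)}$. (3) For any integers $n,m\ge 1$ and any function $f:\mathbb{Z}_n\to\mathbb{Z}_m$, \[\bigl|\{\varphi\in \mathrm{Hom}(\mathbb{Z}_n,\mathbb{Z}_m) : \mathrm{agr}(f,\varphi)\ge \varepsilon\}\bigr|\le \frac{\zeta(2)^2}{\varepsilon^{3}},\] where $\zeta(2)=\pi^2/6$.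
   Context: For finite groups $G,H$, $\mathrm{Hom}(G,H)$ is the set of group homomorphisms $G\to H$. For functions $f,\varphi:G\to H$, $\mathrm{agr}(f,\varphi)=\Pr_{x\sim G}[f(x)=\varphi(x)]$ with $x$ uniform in $G$. Every finite abelian group decomposes as $\bigoplus_p H_p$ with $H_p=\bigoplus_{i=1}^t \mathbb{Z}_{p^{b_i}}$ ($b_i\ge1$) its $p$-component; the $p$-rank of $H$ is the number $t$ of summands in $H_p$. *)

theory Defs
  imports
    "HOL-Algebra.Product_Groups"
    "HOL-Computational_Algebra.Primes"
    "HOL-Probability.Probability_Mass_Function"
begin

text \<open>
  The library's \<^const>\<open>hom\<close> does not constrain a map outside the carrier of its domain, so a
  homomorphism there has many representatives.  To count homomorphisms we keep one representative
  of each, namely the one that is \<^const>\<open>undefined\<close> outside the carrier.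
\<close>

definition Homs :: "('a, 'c) monoid_scheme \<Rightarrow> ('b, 'd) monoid_scheme \<Rightarrow> ('a \<Rightarrow> 'b) set" where
  "Homs G H = hom G H \<inter> extensional (carrier G)"

lemma finite_Homs:
  assumes "finite (carrier G)" "finite (carrier H)"
  shows "finite (Homs G H)"
proof (rule finite_subset)
  show "Homs G H \<subseteq> carrier G \<rightarrow>\<^sub>E carrier H"
    by (auto simp: Homs_def hom_def PiE_def)
  show "finite (carrier G \<rightarrow>\<^sub>E carrier H)"
    using assms by (simp add: finite_PiE)
qed

text \<open>Meaningful for finite nonempty carriers only, as \<^const>\<open>pmf_of_set\<close> is.\<close>

definition agr :: "('a, 'c) monoid_scheme \<Rightarrow> ('a \<Rightarrow> 'b) \<Rightarrow> ('a \<Rightarrow> 'b) \<Rightarrow> real" where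
  "agr G f \<phi> = measure_pmf.prob (pmf_of_set (carrier G)) {x. f x = \<phi> x}"

lemma agr_eq_card:
  assumes "finite (carrier G)" "carrier G \<noteq> {}"
  shows "agr G f \<phi> = card {x \<in> carrier G. f x = \<phi> x} / card (carrier G)"
  using assms by (simp add: agr_def measure_pmf_of_set Int_def)

definition p_part :: "nat \<Rightarrow> nat \<Rightarrow> (nat \<Rightarrow> nat) \<Rightarrow> (nat \<Rightarrow> int) monoid" where
  "p_part p t b = sum_group {..<t} (\<lambda>i. integer_mod_group (p ^ b i))"

text \<open>
  The rank is read off from a decomposition \<open>H \<cong> \<Oplus>\<^sub>q H\<^sub>q\<close> over all primes \<open>q\<close>, where \<open>H\<^sub>q\<close>
  is the direct sum of the \<open>T q\<close> groups \<open>\<int>/q\<^bsup>b q i\<^esup>\<close>, with \<open>b q i \<ge> 1\<close>.  It is a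
  relation between \<open>H\<close> and \<open>t\<close>; for a finite abelian group \<open>H\<close> exactly one \<open>t\<close> satisfies it,
  by the structure theorem.
\<close>

definition has_p_rank :: "nat \<Rightarrow> ('a, 'c) monoid_scheme \<Rightarrow> nat \<Rightarrow> bool" where
  "has_p_rank p H t \<longleftrightarrow>
     (\<exists>(T :: nat \<Rightarrow> nat) (b :: nat \<Rightarrow> nat \<Rightarrow> nat).
        (\<forall>q. prime q \<longrightarrow> (\<forall>i<T q. b q i \<ge> 1)) \<and>
        H \<cong> sum_group {q. prime q} (\<lambda>q. p_part q (T q) (b q)) \<and>
        T p = t)"

end

theory Submission
  imports Defs "HOL-Algebra.Multiplicative_Group" "HOL-Analysis.Gamma_Function"
begin

text \<open>
  The \<open>k\<close>-th power of the agreement of \<open>f\<close> and \<open>\<phi>\<close> is the probability that they agree at \<open>k\<close>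
  independent random points.  Given the points, the homomorphisms agreeing with \<open>f\<close> there are none
  or a coset of those that vanish there, so \<open>\<Sum>\<phi>. agr f \<phi> ^ k\<close> is largest for \<open>f = 0\<close>.  On a cyclic
  group the agreement of \<open>\<psi>\<close> with \<open>0\<close> is the inverse of the order \<open>d\<close> of \<open>\<psi> 1\<close>, hence the list has size
  at most \<open>\<epsilon> ^ (- k) * (\<Sum>d. N d / d ^ k)\<close>, where \<open>N d\<close> bounds the number of elements of \<open>H\<close> killed by \<open>d\<close>.
  For \<open>H\<close> cyclic \<open>N d = d\<close>, and for \<open>d\<close> a power of \<open>p\<close> one can take \<open>N d = d ^ t\<close>.  The theorem
  follows with \<open>k = 2\<close>, \<open>k = t + 1\<close> and \<open>k = 3\<close>, respectively.
\<close>

section \<open>Moments of the agreement\<close>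

text \<open>If some \<open>\<theta>\<close> agrees with \<open>f\<close> on \<open>X\<close>,
  dividing by \<open>\<theta>\<close> injects the left set into the right one. Commutativity of
  \<open>H\<close> makes the quotient of two homomorphisms a homomorphism.\<close>

lemma card_agreeing_Homs_le:
  assumes G: "group G" and H: "comm_group H" and fin: "finite (Homs G H)" and X: "X \<subseteq> carrier G"
  shows "card {\<phi> \<in> Homs G H. \<forall>x\<in>X. f x = \<phi> x} \<le> card {\<psi> \<in> Homs G H. \<forall>x\<in>X. \<one>\<^bsub>H\<^esub> = \<psi> x}"
proof (cases "{\<phi> \<in> Homs G H. \<forall>x\<in>X. f x = \<phi> x} = {}")
  case False
  then obtain \<theta> where \<theta>: "\<theta> \<in> Homs G H" "\<And>x. x \<in> X \<Longrightarrow> f x = \<theta> x" by auto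
  interpret G: group G by fact
  interpret H: comm_group H by fact
  \<comment> \<open>The restriction to the carrier keeps \<open>T \<phi>\<close> extensional, so
    that it is again the chosen representative in \<open>Homs G H\<close>.\<close>
  define T where "T \<phi> = (\<lambda>x\<in>carrier G. \<phi> x \<otimes>\<^bsub>H\<^esub> inv\<^bsub>H\<^esub> \<theta> x)" for \<phi>
  have closed: "\<phi> x \<in> carrier H" if "\<phi> \<in> Homs G H" "x \<in> carrier G" for \<phi> x
    using that by (auto simp: Homs_def hom_def)
  have mult: "\<phi> (x \<otimes>\<^bsub>G\<^esub> y) = \<phi> x \<otimes>\<^bsub>H\<^esub> \<phi> y"
    if "\<phi> \<in> Homs G H" "x \<in> carrier G" "y \<in> carrier G" for \<phi> x y
    using that by (auto simp: Homs_def hom_def)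
  have T_Homs: "T \<phi> \<in> Homs G H" if "\<phi> \<in> Homs G H" for \<phi>
  proof -
    have "T \<phi> \<in> hom G H"
    proof (rule homI)
      fix x y assume x: "x \<in> carrier G" and y: "y \<in> carrier G"
      show "T \<phi> x \<in> carrier H" using that x \<theta>(1) by (simp add: T_def closed)
      show "T \<phi> (x \<otimes>\<^bsub>G\<^esub> y) = T \<phi> x \<otimes>\<^bsub>H\<^esub> T \<phi> y"
        using that x y \<theta>(1) by (simp add: T_def mult closed H.inv_mult H.m_ac)
    qed
    then show ?thesis by (simp add: Homs_def T_def)
  qed
  have "inj_on T (Homs G H)"
  proof (rule inj_onI)
    fix \<phi> \<psi> assume \<phi>: "\<phi> \<in> Homs G H" and \<psi>: "\<psi> \<in> Homs G H" and eq: "T \<phi> = T \<psi>"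
    show "\<phi> = \<psi>"
    proof (rule extensionalityI[of _ "carrier G"])
      fix x assume x: "x \<in> carrier G"
      then have "\<phi> x \<otimes>\<^bsub>H\<^esub> inv\<^bsub>H\<^esub> \<theta> x = \<psi> x \<otimes>\<^bsub>H\<^esub> inv\<^bsub>H\<^esub> \<theta> x"
        using fun_cong[OF eq, of x] by (simp add: T_def)
      then show "\<phi> x = \<psi> x"
        using x \<phi> \<psi> \<theta>(1) by (simp add: closed)
    qed (use \<phi> \<psi> in \<open>auto simp: Homs_def\<close>)
  qed
  then show ?thesis
  proof (intro card_inj_on_le[of T])
    show "T ` {\<phi> \<in> Homs G H. \<forall>x\<in>X. f x = \<phi> x} \<subseteq> {\<psi> \<in> Homs G H. \<forall>x\<in>X. \<one>\<^bsub>H\<^esub> = \<psi> x}"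
    proof clarsimp
      fix \<phi> assume \<phi>: "\<phi> \<in> Homs G H" "\<forall>x\<in>X. f x = \<phi> x"
      then have "\<phi> x \<otimes>\<^bsub>H\<^esub> inv\<^bsub>H\<^esub> \<theta> x = \<one>\<^bsub>H\<^esub>" if "x \<in> X" for x
        using \<theta> X that by (metis H.r_inv closed subsetD)
      then show "T \<phi> \<in> Homs G H \<and> (\<forall>x\<in>X. \<one>\<^bsub>H\<^esub> = T \<phi> x)"
        using T_Homs[OF \<phi>(1)] X by (auto simp: T_def)
    qed
  qed (use fin in \<open>auto intro: inj_on_subset\<close>)
next
  case True
  then show ?thesis by (simp only: card.empty le0)
qed

text \<open>Double counting of the pairs of a homomorphism and a \<open>k\<close>-tuple of points at
  which it agrees with \<open>f\<close>. For each fixed tuple, the trivial map admits at least as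
  many homomorphisms as \<open>f\<close> does.\<close>

lemma sum_agr_power_le:
  assumes G: "group G" and H: "comm_group H" and fin: "finite (carrier G)" "finite (carrier H)"
  shows "(\<Sum>\<phi>\<in>Homs G H. agr G f \<phi> ^ k) \<le> (\<Sum>\<psi>\<in>Homs G H. agr G (\<lambda>_. \<one>\<^bsub>H\<^esub>) \<psi> ^ k)"
proof -
  interpret G: group G by fact
  have fH: "finite (Homs G H)" using fin by (rule finite_Homs)
  have ne: "carrier G \<noteq> {}" by blast
  \<comment> \<open>The moment with its denominator cleared, so that the double count takes place in
    the natural numbers.\<close>
  define N where "N g = (\<Sum>\<phi>\<in>Homs G H. card {x \<in> carrier G. g x = \<phi> x} ^ k)" for g :: "'a \<Rightarrow> 'c"
  have sum_agr: "(\<Sum>\<phi>\<in>Homs G H. agr G g \<phi> ^ k) = real (N g) / real (card (carrier G)) ^ k" for g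
    using fin ne by (simp add: N_def agr_eq_card power_divide sum_divide_distrib)
  have count: "N g = (\<Sum>z\<in>{..<k} \<rightarrow>\<^sub>E carrier G.
      card {\<phi> \<in> Homs G H. \<forall>x\<in>z ` {..<k}. g x = \<phi> x})" for g
  proof -
    have "N g = (\<Sum>\<phi>\<in>Homs G H. card {z \<in> {..<k} \<rightarrow>\<^sub>E carrier G. \<forall>x\<in>z ` {..<k}. g x = \<phi> x})"
      unfolding N_def
    proof (rule sum.cong[OF refl])
      fix \<phi>
      \<comment> \<open>A tuple of points of agreement is a tuple drawn from the agreement set,
        which accounts for the \<open>k\<close>-th power.\<close>
      have "{z \<in> {..<k} \<rightarrow>\<^sub>E carrier G. \<forall>x\<in>z ` {..<k}. g x = \<phi> x} =
        ({..<k} \<rightarrow>\<^sub>E {x \<in> carrier G. g x = \<phi> x})"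
        by (simp add: set_eq_iff PiE_iff) blast
      then show "card {x \<in> carrier G. g x = \<phi> x} ^ k =
          card {z \<in> {..<k} \<rightarrow>\<^sub>E carrier G. \<forall>x\<in>z ` {..<k}. g x = \<phi> x}"
        by (simp add: card_PiE)
    qed
    also have "\<dots> = (\<Sum>z\<in>{..<k} \<rightarrow>\<^sub>E carrier G.
        card {\<phi> \<in> Homs G H. \<forall>x\<in>z ` {..<k}. g x = \<phi> x})"
      using fH fin by (intro sum_multicount_gen) (auto intro: finite_PiE)
    finally show ?thesis .
  qed
  have "N f \<le> N (\<lambda>_. \<one>\<^bsub>H\<^esub>)"
    unfolding count by (intro sum_mono card_agreeing_Homs_le G H fH) auto
  then show ?thesis
    unfolding sum_agr by (intro divide_right_mono) auto
qed

section \<open>Homomorphisms out of a cyclic group\<close>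

text \<open>The residue \<open>x\<close> is the \<open>nat x\<close>-th multiple of the generator.
  Writing the generator as \<open>1 mod int n\<close> covers \<open>n = 1\<close>, where the carrier
  is \<open>{0}\<close> and does not contain 1.\<close>

lemma Homs_integer_mod_group_eq_pow:
  assumes n: "n \<ge> 1" and H: "group H" and \<psi>: "\<psi> \<in> Homs (integer_mod_group n) H"
    and x: "x \<in> carrier (integer_mod_group n)"
  shows "\<psi> x = \<psi> (1 mod int n) [^]\<^bsub>H\<^esub> nat x"
proof -
  have x': "0 \<le> x" "x < int n" using n x by (auto simp: carrier_integer_mod_group)
  have "\<psi> (1 mod int n) [^]\<^bsub>H\<^esub> nat x = \<psi> ((1 mod int n) [^]\<^bsub>integer_mod_group n\<^esub> nat x)"
    using \<psi> n by (intro hom_nat_pow[symmetric] group_integer_mod_group H)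
      (auto simp: Homs_def carrier_integer_mod_group)
  also have "(1 mod int n) [^]\<^bsub>integer_mod_group n\<^esub> nat x = x"
    using x' by (simp add: mod_mult_right_eq)
  finally show ?thesis ..
qed

lemma Homs_integer_mod_group_generator:
  assumes n: "n \<ge> 1" and H: "group H" and \<psi>: "\<psi> \<in> Homs (integer_mod_group n) H"
  shows "\<psi> (1 mod int n) \<in> carrier H" and "\<psi> (1 mod int n) [^]\<^bsub>H\<^esub> n = \<one>\<^bsub>H\<^esub>"
proof -
  have hom: "\<psi> \<in> hom (integer_mod_group n) H" using \<psi> by (simp add: Homs_def)
  have 1: "1 mod int n \<in> carrier (integer_mod_group n)"
    using n by (auto simp: carrier_integer_mod_group)
  show "\<psi> (1 mod int n) \<in> carrier H" using hom 1 by (auto simp: hom_def)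
  have "\<psi> (1 mod int n) [^]\<^bsub>H\<^esub> n = \<psi> ((1 mod int n) [^]\<^bsub>integer_mod_group n\<^esub> n)"
    using hom_nat_pow[OF hom 1 group_integer_mod_group H, symmetric] .
  also have "\<dots> = \<psi> \<one>\<^bsub>integer_mod_group n\<^esub>" by simp
  also have "\<dots> = \<one>\<^bsub>H\<^esub>"
    using hom H by (intro hom_one) auto
  finally show "\<psi> (1 mod int n) [^]\<^bsub>H\<^esub> n = \<one>\<^bsub>H\<^esub>" .
qed

text \<open>The kernel consists of the multiples of the order \<open>d\<close> in
  \<open>[0, n)\<close>. With \<open>n = d * c\<close> there are \<open>c\<close> of them, a
  proportion \<open>c / n = 1 / d\<close>.\<close>

lemma agr_one_integer_mod_group:
  assumes n: "n \<ge> 1" and H: "group H" and \<psi>: "\<psi> \<in> Homs (integer_mod_group n) H"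
  shows "agr (integer_mod_group n) (\<lambda>_. \<one>\<^bsub>H\<^esub>) \<psi> = 1 / group.ord H (\<psi> (1 mod int n))"
proof -
  interpret H: group H by fact
  define h where "h = \<psi> (1 mod int n)"
  define d where "d = H.ord h"
  have h: "h \<in> carrier H" "h [^]\<^bsub>H\<^esub> n = \<one>\<^bsub>H\<^esub>"
    unfolding h_def by (rule Homs_integer_mod_group_generator[OF n H \<psi>])+
  have "d dvd n" using h by (simp add: d_def H.pow_eq_id)
  then obtain c where c: "n = d * c" by blast
  have pos: "d > 0" "c > 0" using n c by (auto intro: Nat.gr0I)
  have "{x \<in> carrier (integer_mod_group n). \<one>\<^bsub>H\<^esub> = \<psi> x} = (\<lambda>i. int (d * i)) ` {..<c}"
  proof (intro equalityI subsetI)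
    fix x assume x: "x \<in> {x \<in> carrier (integer_mod_group n). \<one>\<^bsub>H\<^esub> = \<psi> x}"
    then have "h [^]\<^bsub>H\<^esub> nat x = \<one>\<^bsub>H\<^esub>"
      using Homs_integer_mod_group_eq_pow[OF n H \<psi>, of x] by (simp add: h_def)
    then have "d dvd nat x" using h by (simp add: d_def H.pow_eq_id)
    then obtain i where i: "nat x = d * i" by blast
    have "0 \<le> x" "x < int n" using x n by (auto simp: carrier_integer_mod_group)
    then have "x = int (d * i)" "d * i < d * c" using i c by linarith+
    then show "x \<in> (\<lambda>i. int (d * i)) ` {..<c}" using pos by auto
  next
    fix x assume "x \<in> (\<lambda>i. int (d * i)) ` {..<c}"
    then obtain i where i: "x = int (d * i)" "i < c" by auto
    have "d * i < n" using i pos c by simp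
    then have x: "x \<in> carrier (integer_mod_group n)"
      using i n by (simp add: carrier_integer_mod_group del: of_nat_mult)
    have "h [^]\<^bsub>H\<^esub> (d * i) = \<one>\<^bsub>H\<^esub>" using h by (simp add: d_def H.pow_eq_id)
    then have "\<psi> x = \<one>\<^bsub>H\<^esub>"
      using Homs_integer_mod_group_eq_pow[OF n H \<psi> x] unfolding i(1) nat_int h_def by simp
    with x show "x \<in> {x \<in> carrier (integer_mod_group n). \<one>\<^bsub>H\<^esub> = \<psi> x}" by simp
  qed
  moreover have "card ((\<lambda>i. int (d * i)) ` {..<c}) = c"
    using pos by (subst card_image) (auto simp: inj_on_def)
  ultimately have "card {x \<in> carrier (integer_mod_group n). \<one>\<^bsub>H\<^esub> = \<psi> x} = c" by simp
  moreover have "carrier (integer_mod_group n) = {0..<int n}"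
    using n by (simp add: carrier_integer_mod_group)
  ultimately have "agr (integer_mod_group n) (\<lambda>_. \<one>\<^bsub>H\<^esub>) \<psi> = real c / real n"
    using n by (subst agr_eq_card) auto
  also have "\<dots> = 1 / real d" using pos c by simp
  finally show ?thesis unfolding d_def h_def .
qed

text \<open>A homomorphism is determined by the image of the generator, so the sum can be taken over
  elements of \<open>H\<close> and sorted by their order. Elements of order \<open>d\<close> are
  then bounded by all those killed by \<open>d\<close>, the quantity that is estimated
  later.\<close>

lemma sum_agr_one_power_le:
  assumes n: "n \<ge> 1" and H: "group H" and fin: "finite (carrier H)"
  shows "(\<Sum>\<psi>\<in>Homs (integer_mod_group n) H. agr (integer_mod_group n) (\<lambda>_. \<one>\<^bsub>H\<^esub>) \<psi> ^ k)
    \<le> (\<Sum>d | d dvd n. real (card {h \<in> carrier H. h [^]\<^bsub>H\<^esub> d = \<one>\<^bsub>H\<^esub>}) / real d ^ k)"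
proof -
  interpret H: group H by fact
  let ?Z = "integer_mod_group n"
  let ?ev = "\<lambda>\<psi>. \<psi> (1 mod int n)"
  define A where "A = {h \<in> carrier H. h [^]\<^bsub>H\<^esub> n = \<one>\<^bsub>H\<^esub>}"
  have finA: "finite A" using fin by (simp add: A_def)
  have inj: "inj_on ?ev (Homs ?Z H)"
  proof (rule inj_onI)
    fix \<phi> \<psi> assume "\<phi> \<in> Homs ?Z H" "\<psi> \<in> Homs ?Z H" and "?ev \<phi> = ?ev \<psi>"
    then show "\<phi> = \<psi>"
      by (intro extensionalityI[of _ "carrier ?Z"])
        (auto simp: Homs_integer_mod_group_eq_pow[OF n H] Homs_def[of ?Z H])
  qed
  have "(\<Sum>\<psi>\<in>Homs ?Z H. agr ?Z (\<lambda>_. \<one>\<^bsub>H\<^esub>) \<psi> ^ k) = (\<Sum>\<psi>\<in>Homs ?Z H. 1 / real (H.ord (?ev \<psi>)) ^ k)"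
    using agr_one_integer_mod_group[OF n H] by (simp add: power_divide)
  also have "\<dots> = (\<Sum>h\<in>?ev ` Homs ?Z H. 1 / real (H.ord h) ^ k)"
    using inj by (simp add: sum.reindex)
  also have "\<dots> \<le> (\<Sum>h\<in>A. 1 / real (H.ord h) ^ k)"
    using finA Homs_integer_mod_group_generator[OF n H] by (intro sum_mono2) (auto simp: A_def)
  \<comment> \<open>Elements of \<open>A\<close> are killed by \<open>n\<close>, so their orders
    divide \<open>n\<close> and the fibres over the divisors exhaust \<open>A\<close>.\<close>
  also have "\<dots> = (\<Sum>d | d dvd n. \<Sum>h | h \<in> A \<and> H.ord h = d. 1 / real (H.ord h) ^ k)"
    using finA n by (subst sum.group) (auto simp: A_def H.pow_eq_id)
  also have "\<dots> = (\<Sum>d | d dvd n. real (card {h \<in> A. H.ord h = d}) / real d ^ k)"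
    by (intro sum.cong) auto
  also have "\<dots> \<le> (\<Sum>d | d dvd n. real (card {h \<in> carrier H. h [^]\<^bsub>H\<^esub> d = \<one>\<^bsub>H\<^esub>}) / real d ^ k)"
    using fin by (intro sum_mono divide_right_mono) (auto simp: A_def intro!: card_mono)
  finally show ?thesis .
qed

section \<open>From torsion counts to list size\<close>

text \<open>Markov's inequality for the moment of order \<open>t + e\<close>. The torsion bound
  cancels \<open>d ^ t\<close>, and \<open>e\<close> is the exponent left over to control the
  divisor sum: 1 suffices for powers of \<open>p\<close>, while 2 makes the sum bounded uniformly in
  \<open>n\<close>.\<close>

lemma card_list_le:
  assumes n: "n \<ge> 1" and H: "comm_group H" and fin: "finite (carrier H)" and \<epsilon>: "\<epsilon> > 0"
    and N: "\<And>d. d dvd n \<Longrightarrow> card {h \<in> carrier H. h [^]\<^bsub>H\<^esub> d = \<one>\<^bsub>H\<^esub>} \<le> d ^ t"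
  shows "real (card {\<phi> \<in> Homs (integer_mod_group n) H. agr (integer_mod_group n) f \<phi> \<ge> \<epsilon>})
    \<le> (\<Sum>d | d dvd n. 1 / real d ^ e) / \<epsilon> ^ (t + e)"
proof -
  let ?Z = "integer_mod_group n"
  let ?L = "{\<phi> \<in> Homs ?Z H. agr ?Z f \<phi> \<ge> \<epsilon>}"
  interpret H: comm_group H by fact
  have finZ: "finite (carrier ?Z)" using n by (simp add: carrier_integer_mod_group)
  have "real (card ?L) * \<epsilon> ^ (t + e) \<le> (\<Sum>\<phi>\<in>?L. agr ?Z f \<phi> ^ (t + e))"
    using \<epsilon> by (subst sum_bounded_below) (auto intro: power_mono)
  also have "\<dots> \<le> (\<Sum>\<phi>\<in>Homs ?Z H. agr ?Z f \<phi> ^ (t + e))"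
    by (intro sum_mono2 finite_Homs finZ fin) (auto simp: agr_def)
  also have "\<dots> \<le> (\<Sum>\<psi>\<in>Homs ?Z H. agr ?Z (\<lambda>_. \<one>\<^bsub>H\<^esub>) \<psi> ^ (t + e))"
    by (intro sum_agr_power_le H finZ fin) simp
  also have "\<dots> \<le> (\<Sum>d | d dvd n.
      real (card {h \<in> carrier H. h [^]\<^bsub>H\<^esub> d = \<one>\<^bsub>H\<^esub>}) / real d ^ (t + e))"
    by (intro sum_agr_one_power_le n fin) (rule H.group_axioms)
  also have "\<dots> \<le> (\<Sum>d | d dvd n. 1 / real d ^ e)"
  proof (rule sum_mono)
    fix d assume "d \<in> {d. d dvd n}"
    then have d: "d dvd n" "d > 0" using n by (auto intro: Nat.gr0I)
    have "real (card {h \<in> carrier H. h [^]\<^bsub>H\<^esub> d = \<one>\<^bsub>H\<^esub>}) \<le> real d ^ t"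
      using N[OF d(1)] by (metis of_nat_le_iff of_nat_power)
    then have "real (card {h \<in> carrier H. h [^]\<^bsub>H\<^esub> d = \<one>\<^bsub>H\<^esub>}) / real d ^ (t + e)
        \<le> real d ^ t / real d ^ (t + e)"
      by (rule divide_right_mono) simp
    also have "\<dots> = 1 / real d ^ e" using d by (simp add: power_add)
    finally show "real (card {h \<in> carrier H. h [^]\<^bsub>H\<^esub> d = \<one>\<^bsub>H\<^esub>}) / real d ^ (t + e) \<le> 1 / real d ^ e" .
  qed
  finally show ?thesis using \<epsilon> by (simp add: pos_le_divide_eq)
qed

section \<open>Torsion in cyclic groups and in groups of given rank\<close>

text \<open>For \<open>0 \<le> h < m\<close> killed by \<open>d\<close>, the product
  \<open>d * h\<close> equals \<open>m * k\<close> with \<open>0 \<le> k < d\<close>, and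
  \<open>k\<close> determines \<open>h\<close>.\<close>

lemma card_torsion_integer_mod_group_le:
  assumes m: "m \<ge> 1" and d: "d \<ge> 1"
  shows "card {h \<in> carrier (integer_mod_group m).
    h [^]\<^bsub>integer_mod_group m\<^esub> d = \<one>\<^bsub>integer_mod_group m\<^esub>} \<le> d"
proof -
  let ?A = "{h \<in> carrier (integer_mod_group m).
    h [^]\<^bsub>integer_mod_group m\<^esub> d = \<one>\<^bsub>integer_mod_group m\<^esub>}"
  have *: "0 \<le> h" "h < int m" "int d * h = int m * (int d * h div int m)"
      "int d * h div int m \<in> {0..<int d}" if "h \<in> ?A" for h
  proof -
    show h: "0 \<le> h" "h < int m" using that m by (auto simp: carrier_integer_mod_group)
    have "int m dvd int d * h" using that by auto
    then show eq: "int d * h = int m * (int d * h div int m)" by (rule dvd_mult_div_cancel[symmetric])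
    have "int d * h < int m * int d" using h(2) d by (simp add: mult.commute[of "int m"])
    with eq have "int m * (int d * h div int m) < int m * int d" by (rule ord_eq_less_trans[OF sym])
    then show "int d * h div int m \<in> {0..<int d}"
      using h m by (auto simp: mult_less_cancel_left pos_imp_zdiv_nonneg_iff)
  qed
  have "card ?A \<le> card {0..<int d}"
  proof (rule card_inj_on_le[of "\<lambda>h. int d * h div int m"])
    show "inj_on (\<lambda>h. int d * h div int m) ?A"
    proof (rule inj_onI)
      fix x y assume "x \<in> ?A" "y \<in> ?A" "int d * x div int m = int d * y div int m"
      then have "int d * x = int d * y" using *(3)[of x] *(3)[of y] by simp
      then show "x = y" using d by simp
    qed
    show "(\<lambda>h. int d * h div int m) ` ?A \<subseteq> {0..<int d}" using *(4) by blast
  qed simp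
  then show ?thesis by simp
qed

lemma sum_group_proj_hom:
  assumes "\<And>i. i \<in> I \<Longrightarrow> group (G i)" and "i \<in> I"
  shows "(\<lambda>x. x i) \<in> hom (sum_group I G) (G i)"
proof (rule homI)
  fix x y assume "x \<in> carrier (sum_group I G)"
  then have "x \<in> (\<Pi>\<^sub>E i\<in>I. carrier (G i))" using assms(1) by (simp add: carrier_sum_group)
  then show "x i \<in> carrier (G i)" using assms(2) by (rule PiE_mem)
  show "(x \<otimes>\<^bsub>sum_group I G\<^esub> y) i = x i \<otimes>\<^bsub>G i\<^esub> y i" using assms(2) by simp
qed

lemma sum_group_extensional:
  assumes "\<And>i. i \<in> I \<Longrightarrow> group (G i)" and "x \<in> carrier (sum_group I G)"
  shows "x \<in> extensional I"
  using assms by (auto simp: carrier_sum_group PiE_iff)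

text \<open>An element killed by a power of \<open>p\<close> has trivial components at all other
  primes, so it is determined by its \<open>p\<close>-component. Each of the \<open>t\<close>
  coordinates there is a torsion element of a cyclic group, with at most \<open>p ^ j\<close>
  possible values.\<close>

lemma card_torsion_le_of_has_p_rank:
  assumes p: "prime p" and H: "group H" and rank: "has_p_rank p H t"
  shows "card {h \<in> carrier H. h [^]\<^bsub>H\<^esub> (p ^ j) = \<one>\<^bsub>H\<^esub>} \<le> (p ^ j) ^ t"
proof -
  obtain T b where iso: "H \<cong> sum_group {q. prime q} (\<lambda>q. p_part q (T q) (b q))" and T: "T p = t"
    using rank by (auto simp: has_p_rank_def)
  define d where "d = p ^ j"
  have d: "d \<ge> 1" using p by (simp add: d_def prime_gt_0_nat Suc_leI)
  define Z where "Z q i = integer_mod_group (q ^ b q i)" for q i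
  define P where "P q = sum_group {..<T q} (Z q)" for q
  define S where "S = sum_group {q. prime q} P"
  have group_Z: "group (Z q i)" for q i by (simp add: Z_def)
  have group_P: "group (P q)" for q unfolding P_def using group_Z by (rule sum_group)
  have group_S: "group S" unfolding S_def using group_P by (rule sum_group)
  have P_ext: "x \<in> extensional {..<T q}" if "x \<in> carrier (P q)" for x q
    using group_Z that unfolding P_def by (rule sum_group_extensional)
  have S_ext: "x \<in> extensional {q. prime q}" if "x \<in> carrier S" for x
    using group_P that unfolding S_def by (rule sum_group_extensional)
  define tor where "tor K = {h \<in> carrier K. h [^]\<^bsub>K\<^esub> d = \<one>\<^bsub>K\<^esub>}" for K :: "int monoid"
  obtain g where g: "g \<in> iso H S"
    using iso by (auto simp: is_iso_def S_def P_def[abs_def] Z_def[abs_def] p_part_def)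
  then have g_hom: "g \<in> hom H S" and g_bij: "bij_betw g (carrier H) (carrier S)"
    by (auto simp: iso_def)
  let ?A = "{h \<in> carrier H. h [^]\<^bsub>H\<^esub> d = \<one>\<^bsub>H\<^esub>}"
  have S_mem: "g h \<in> carrier S" if "h \<in> ?A" for h
    using that g_hom by (auto simp: hom_def)
  have P_mem: "g h q \<in> carrier (P q)" if "h \<in> ?A" "prime q" for h q
    using S_mem[OF that(1)] that(2) group_P by (auto simp: S_def carrier_sum_group)
  \<comment> \<open>Taking a coordinate is a homomorphism, so it preserves being killed by
    \<open>d\<close>.\<close>
  have tor_mem: "g h q i \<in> tor (Z q i)" if h: "h \<in> ?A" and q: "prime q" and i: "i < T q" for h q i
  proof -
    have proj_q: "(\<lambda>x. x q) \<in> hom S (P q)"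
      unfolding S_def using group_P q by (intro sum_group_proj_hom[where G = P]) auto
    have proj_i: "(\<lambda>x. x i) \<in> hom (P q) (Z q i)"
      unfolding P_def using group_Z i by (intro sum_group_proj_hom[where G = "Z q"]) auto
    have "(\<lambda>x. x i) \<circ> ((\<lambda>x. x q) \<circ> g) \<in> hom H (Z q i)"
      using g_hom proj_q proj_i by (metis hom_compose)
    then have hom: "(\<lambda>h. g h q i) \<in> hom H (Z q i)" by (simp add: o_def)
    have "g h q i [^]\<^bsub>Z q i\<^esub> d = g (h [^]\<^bsub>H\<^esub> d) q i"
      using hom_nat_pow[OF hom, of h d] h H group_Z by simp
    also have "\<dots> = \<one>\<^bsub>Z q i\<^esub>"
      using hom_one[OF hom H group_Z] h by simp
    finally show ?thesis using hom h by (auto simp: tor_def hom_def)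
  qed
  \<comment> \<open>Multiplication by \<open>d = p ^ j\<close> is injective modulo a power of
    another prime.\<close>
  have tor_trivial: "z = 0" if "z \<in> tor (Z q i)" "prime q" "q \<noteq> p" for z q i
  proof -
    have "q ^ b q i > 0" using that(2) by (simp add: prime_gt_0_nat)
    then have z: "0 \<le> z" "z < int (q ^ b q i)" "int (q ^ b q i) dvd int d * z"
      using that(1) by (auto simp: tor_def Z_def carrier_integer_mod_group mod_eq_0_iff_dvd)
    have "coprime (q ^ b q i) d"
      unfolding d_def using p that by (simp add: primes_coprime)
    then have "int (q ^ b q i) dvd z"
      using z(3) by (meson coprime_dvd_mult_right_iff coprime_int_iff)
    then show "z = 0" using z by (metis zdvd_not_zless order_le_less)
  qed
  have fin_tor: "finite (tor (Z p i))" for i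
    by (rule finite_subset[of _ "{0..<int (p ^ b p i)}"])
      (use p in \<open>auto simp: tor_def Z_def carrier_integer_mod_group prime_gt_0_nat\<close>)
  have "card ?A \<le> card (\<Pi>\<^sub>E i\<in>{..<t}. tor (Z p i))"
  proof (rule card_inj_on_le[of "\<lambda>h. g h p"])
    show "(\<lambda>h. g h p) ` ?A \<subseteq> (\<Pi>\<^sub>E i\<in>{..<t}. tor (Z p i))"
    proof (rule image_subsetI)
      fix h assume h: "h \<in> ?A"
      have "g h p \<in> extensional {..<t}"
        using P_ext[OF P_mem[OF h p]] unfolding T .
      then show "g h p \<in> (\<Pi>\<^sub>E i\<in>{..<t}. tor (Z p i))"
        using tor_mem[OF h p] unfolding T PiE_iff by blast
    qed
    show "inj_on (\<lambda>h. g h p) ?A"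
    proof (rule inj_onI)
      fix x y assume x: "x \<in> ?A" and y: "y \<in> ?A" and eq: "g x p = g y p"
      have "g x = g y"
      \<comment> \<open>Elements of the sum are extensional over the primes and, inside each
        component, over the summands, so coordinatewise equality is enough. For
        \<open>q \<noteq> p\<close> both coordinates are 0.\<close>
      proof (rule extensionalityI[of _ "{q. prime q}"])
        fix q assume "q \<in> {q :: nat. prime q}"
        then have q: "prime q" by simp
        show "g x q = g y q"
        proof (cases "q = p")
          case False
          show ?thesis
          proof (rule extensionalityI[of _ "{..<T q}"])
            fix i assume "i \<in> {..<T q}"
            then show "g x q i = g y q i"
              using tor_mem[OF x q] tor_mem[OF y q] tor_trivial[OF _ q False] by (metis lessThan_iff)
          qed (fact P_ext[OF P_mem[OF x q]] P_ext[OF P_mem[OF y q]])+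
        qed (use eq in simp)
      qed (fact S_ext[OF S_mem[OF x]] S_ext[OF S_mem[OF y]])+
      then show "x = y" using x y g_bij by (auto simp: bij_betw_def inj_on_def)
    qed
  qed (use fin_tor in \<open>auto intro: finite_PiE\<close>)
  also have "\<dots> = (\<Prod>i<t. card (tor (Z p i)))" by (simp add: card_PiE)
  also have "\<dots> \<le> (\<Prod>i<t. d)"
  proof (rule prod_mono)
    fix i
    have "p ^ b p i \<ge> 1" using p by (simp add: prime_gt_0_nat Suc_leI)
    then show "0 \<le> card (tor (Z p i)) \<and> card (tor (Z p i)) \<le> d"
      using card_torsion_integer_mod_group_le[OF _ d, of "p ^ b p i"] by (simp add: tor_def Z_def)
  qed
  finally show ?thesis by (simp add: d_def)
qed

section \<open>Divisor sums and the three bounds\<close>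

text \<open>The divisors are the powers of \<open>p\<close> up to \<open>p ^ r\<close>, so this is a
  partial sum of the geometric series of ratio \<open>1 / p\<close>.\<close>

lemma sum_inverse_divisors_prime_power_le:
  assumes p: "prime p"
  shows "(\<Sum>d | d dvd p ^ r. 1 / real d) \<le> real p / (real p - 1)"
proof -
  have p1: "real p > 1" using prime_gt_1_nat[OF p] by simp
  have "{d. d dvd p ^ r} = (\<lambda>j. p ^ j) ` {..r}"
    using p by (auto simp: divides_primepow_nat)
  then have "(\<Sum>d | d dvd p ^ r. 1 / real d) = (\<Sum>j\<le>r. (1 / real p) ^ j)"
    using p1 by (simp add: sum.reindex inj_on_def power_divide)
  also have "\<dots> \<le> (\<Sum>j. (1 / real p) ^ j)"
    using p1 by (intro sum_le_suminf summable_geometric) auto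
  also have "\<dots> = real p / (real p - 1)"
    using p1 by (subst suminf_geometric) (auto simp: field_simps)
  finally show ?thesis .
qed

text \<open>The divisors lie among \<open>1, ..., n\<close>, so the sum is at most a partial sum of
  the Basel series. The shift by \<open>Suc\<close> matches its indexing from 0.\<close>

lemma sum_inverse_squares_divisors_le:
  assumes n: "n \<ge> 1"
  shows "(\<Sum>d | d dvd n. 1 / real d ^ 2) \<le> pi\<^sup>2 / 6"
proof -
  have "{d. d dvd n} \<subseteq> Suc ` {..<n}"
  proof
    fix d assume "d \<in> {d. d dvd n}"
    then have "0 < d" "d \<le> n" using n by (auto intro: Nat.gr0I dvd_imp_le)
    then show "d \<in> Suc ` {..<n}" by (intro image_eqI[of _ _ "d - 1"]) auto
  qed
  then have "(\<Sum>d | d dvd n. 1 / real d ^ 2) \<le> (\<Sum>d\<in>Suc ` {..<n}. 1 / real d ^ 2)"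
    by (intro sum_mono2) auto
  also have "\<dots> = (\<Sum>j<n. 1 / (real j + 1)\<^sup>2)"
    by (simp add: sum.reindex add.commute)
  also have "\<dots> \<le> pi\<^sup>2 / 6"
    using sum_le_suminf[OF sums_summable[OF inverse_squares_sums], of "{..<n}"]
      sums_unique[OF inverse_squares_sums] by (simp add: add.commute)
  finally show ?thesis .
qed

theorem theorem1p3:
  fixes p r :: nat and \<epsilon> :: real
  assumes "prime p" and "r \<ge> 1" and "\<epsilon> > 0"
  shows
    "(\<forall>s f. s \<ge> 1 \<longrightarrow>
        f \<in> carrier (integer_mod_group (p ^ r)) \<rightarrow> carrier (integer_mod_group (p ^ s)) \<longrightarrow>
        real (card {\<phi> \<in> Homs (integer_mod_group (p ^ r)) (integer_mod_group (p ^ s)).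
                     agr (integer_mod_group (p ^ r)) f \<phi> \<ge> \<epsilon>})
          \<le> real p / (real p - 1) * (1 / \<epsilon> ^ 2))
     \<and>
     (\<forall>(H :: ('a, 'b) monoid_scheme) t f.
        comm_group H \<longrightarrow> finite (carrier H) \<longrightarrow> has_p_rank p H t \<longrightarrow> t \<ge> 1 \<longrightarrow>
        f \<in> carrier (integer_mod_group (p ^ r)) \<rightarrow> carrier H \<longrightarrow>
        real (card {\<phi> \<in> Homs (integer_mod_group (p ^ r)) H.
                     agr (integer_mod_group (p ^ r)) f \<phi> \<ge> \<epsilon>})
          \<le> 2 * \<epsilon> powi (- (int t + 1)))
     \<and>
     (\<forall>n m f. n \<ge> 1 \<longrightarrow> m \<ge> 1 \<longrightarrow>
        f \<in> carrier (integer_mod_group n) \<rightarrow> carrier (integer_mod_group m) \<longrightarrow>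
        real (card {\<phi> \<in> Homs (integer_mod_group n) (integer_mod_group m).
                     agr (integer_mod_group n) f \<phi> \<ge> \<epsilon>})
          \<le> (pi\<^sup>2 / 6) ^ 2 / \<epsilon> ^ 3)"
proof (intro conjI allI impI)
  have p_pow: "p ^ j \<ge> 1" for j using assms(1) by (simp add: prime_gt_0_nat Suc_leI)
  note geom = sum_inverse_divisors_prime_power_le[OF assms(1), of r]
  \<comment> \<open>The case \<open>t = 1\<close> of \<open>card_list_le\<close>, shared by the
    first and third claims, with \<open>e = 1\<close> and \<open>e = 2\<close> respectively.\<close>
  have cyclic: "real (card {\<phi> \<in> Homs (integer_mod_group n) (integer_mod_group m).
      agr (integer_mod_group n) f \<phi> \<ge> \<epsilon>}) \<le> (\<Sum>d | d dvd n. 1 / real d ^ e) / \<epsilon> ^ (1 + e)"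
    if "n \<ge> 1" "m \<ge> 1" for n m e f
  proof (rule card_list_le)
    fix d assume "d dvd n"
    then have "d \<ge> 1" using that by (auto intro: Nat.gr0I)
    then show "card {h \<in> carrier (integer_mod_group m).
        h [^]\<^bsub>integer_mod_group m\<^esub> d = \<one>\<^bsub>integer_mod_group m\<^esub>} \<le> d ^ 1"
      using card_torsion_integer_mod_group_le[OF that(2)] by simp
  qed (use that assms in \<open>auto simp: carrier_integer_mod_group\<close>)
  show "real (card {\<phi> \<in> Homs (integer_mod_group (p ^ r)) (integer_mod_group (p ^ s)).
      agr (integer_mod_group (p ^ r)) f \<phi> \<ge> \<epsilon>}) \<le> real p / (real p - 1) * (1 / \<epsilon> ^ 2)" for s f
  proof -
    have "(\<Sum>d | d dvd p ^ r. 1 / real d) / \<epsilon> ^ 2 \<le> real p / (real p - 1) / \<epsilon> ^ 2"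
      using geom by (rule divide_right_mono) simp
    then show ?thesis
      using cyclic[OF p_pow p_pow, of r s f 1] by (simp add: numeral_2_eq_2)
  qed
  show "real (card {\<phi> \<in> Homs (integer_mod_group (p ^ r)) H.
      agr (integer_mod_group (p ^ r)) f \<phi> \<ge> \<epsilon>}) \<le> 2 * \<epsilon> powi (- (int t + 1))"
    if H: "comm_group H" "finite (carrier H)" "has_p_rank p H t"
    for H :: "('a, 'b) monoid_scheme" and t f
  proof -
    have "real (card {\<phi> \<in> Homs (integer_mod_group (p ^ r)) H.
        agr (integer_mod_group (p ^ r)) f \<phi> \<ge> \<epsilon>}) \<le> (\<Sum>d | d dvd p ^ r. 1 / real d ^ 1) / \<epsilon> ^ (t + 1)"
    proof (rule card_list_le)
      fix d assume "d dvd p ^ r"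
      then obtain j where "d = p ^ j" using assms(1) by (auto simp: divides_primepow_nat)
      then show "card {h \<in> carrier H. h [^]\<^bsub>H\<^esub> d = \<one>\<^bsub>H\<^esub>} \<le> d ^ t"
        using card_torsion_le_of_has_p_rank[OF assms(1) comm_group.axioms(2)[OF H(1)] H(3)] by simp
    qed (use H p_pow assms in auto)
    also have "\<dots> \<le> 2 / \<epsilon> ^ (t + 1)"
    proof (rule divide_right_mono)
      \<comment> \<open>The constant 2 is the worst case of the geometric bound, attained at
        \<open>p = 2\<close>.\<close>
      have "real p / (real p - 1) \<le> 2" using prime_ge_2_nat[OF assms(1)] by (simp add: field_simps)
      then show "(\<Sum>d | d dvd p ^ r. 1 / real d ^ 1) \<le> 2" using geom by simp
    qed (use assms in simp)
    also have "\<dots> = 2 * \<epsilon> powi (- (int t + 1))"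
    proof -
      have "int t + 1 = int (t + 1)" by simp
      then show ?thesis by (simp only: power_int_minus power_int_of_nat divide_inverse)
    qed
    finally show ?thesis .
  qed
  show "real (card {\<phi> \<in> Homs (integer_mod_group n) (integer_mod_group m).
      agr (integer_mod_group n) f \<phi> \<ge> \<epsilon>}) \<le> (pi\<^sup>2 / 6) ^ 2 / \<epsilon> ^ 3"
    if n: "n \<ge> 1" and m: "m \<ge> 1" for n m f
  proof -
    \<comment> \<open>The moment bound yields a single factor \<open>pi\<^sup>2 / 6\<close>. It is
      weakened to the square, which is larger because the factor is at least 1; the divisor sum for
      \<open>n = 1\<close> shows this.\<close>
    have "1 \<le> pi\<^sup>2 / 6" using sum_inverse_squares_divisors_le[of 1] by simp
    then have "pi\<^sup>2 / 6 \<le> (pi\<^sup>2 / 6) ^ 2" by (rule self_le_power) simp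
    then have "(\<Sum>d | d dvd n. 1 / real d ^ 2) / \<epsilon> ^ 3 \<le> (pi\<^sup>2 / 6) ^ 2 / \<epsilon> ^ 3"
      using sum_inverse_squares_divisors_le[OF n] assms by (intro divide_right_mono) auto
    then show ?thesis
      using cyclic[OF n m, of f 2] by (simp add: numeral_3_eq_3 numeral_2_eq_2)
  qed
qed

end
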